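(* Let $f(\lambda):=\sum_{k=0}^\infty\alpha_k\lambda^k$ be a power series with complex coefficients, convergent on the open disk $D(0,R)$, $R>0$, and let $f_a(\lambda):=\sum_{k=0}^\infty|\alpha_k|\lambda^k$. If $A$ and $B$ are commuting positive semidefinite matrices in $M_n(\mathbb{C})$ with $\operatorname{tr}(A^p)<R$ and $\operatorname{tr}(B^q)<R$, where $p,q>1$ with $\frac1p+\frac1q=1$, then $$\left|\operatorname{tr}(f(AB))\right|\le\left[\operatorname{tr}(f_a(A^p))\right]^{1/p}\left[\operatorname{tr}(f_a(B^q))\right]^{1/q}.$$
   Context: $D(0,R)=\{z\in\mathbb{C}:|z|<R\}$ if $R<\infty$ and $D(0,\infty)=\mathbb{C}$. $M_n(\mathbb{C})$ is the algebra of complex $n\times n$ matrices, and $f(T):=\sum_{k=0}^\infty\alpha_kT^k$ with $T^0=I_n$; similarly for $f_a$. *)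

theory Defs
  imports "HOL-Analysis.Analysis"
begin

definition conj_transpose :: "complex^'n^'m \<Rightarrow> complex^'m^'n" where
  "conj_transpose A = (\<chi> i j. cnj (A $ j $ i))"

definition hermitian :: "complex^'n^'n \<Rightarrow> bool" where
  "hermitian A \<longleftrightarrow> conj_transpose A = A"

definition unitary :: "complex^'n^'n \<Rightarrow> bool" where
  "unitary U \<longleftrightarrow> conj_transpose U ** U = mat 1 \<and> U ** conj_transpose U = mat 1"

definition quadratic_form :: "complex^'n^'n \<Rightarrow> complex^'n \<Rightarrow> complex" where
  "quadratic_form A x = (\<Sum>i\<in>UNIV. cnj (x $ i) * (A *v x) $ i)"

definition positive_semidefinite :: "complex^'n^'n \<Rightarrow> bool" where
  "positive_semidefinite A \<longleftrightarrow> hermitian A \<and> (\<forall>x. 0 \<le> Re (quadratic_form A x))"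

definition real_diagonal :: "('n \<Rightarrow> real) \<Rightarrow> complex^'n^'n" where
  "real_diagonal d = (\<chi> i j. if i = j then complex_of_real (d i) else 0)"

text \<open>
  Functional calculus of a Hermitian matrix: apply \<open>g\<close> to the eigenvalues in a unitary
  diagonalization. The result does not depend on the diagonalization, see
  \<open>hermitian_fun_diagonalization\<close> below.
\<close>

definition hermitian_fun :: "(real \<Rightarrow> real) \<Rightarrow> complex^'n^'n \<Rightarrow> complex^'n^'n" where
  "hermitian_fun g A =
     (THE X. \<exists>U d. unitary U \<and> A = U ** real_diagonal d ** conj_transpose U \<and>
                   X = U ** real_diagonal (\<lambda>i. g (d i)) ** conj_transpose U)"

definition psd_powr :: "complex^'n^'n \<Rightarrow> real \<Rightarrow> complex^'n^'n" where
  "psd_powr A p = hermitian_fun (\<lambda>t. t powr p) A"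

text \<open>
  The library's \<open>^\<close> and \<open>*\<close> on \<open>complex^'n^'n\<close> are componentwise, hence a separate
  power for the matrix product \<open>**\<close>.
\<close>

primrec matrix_power :: "complex^'n^'n \<Rightarrow> nat \<Rightarrow> complex^'n^'n" where
  "matrix_power T 0 = mat 1"
| "matrix_power T (Suc k) = T ** matrix_power T k"

definition matrix_series :: "(nat \<Rightarrow> complex) \<Rightarrow> complex^'n^'n \<Rightarrow> complex^'n^'n" where
  "matrix_series a T = (\<Sum>k. \<chi> i j. a k * matrix_power T k $ i $ j)"

lemma real_diagonal_mult_left:
  "(real_diagonal d ** W) $ i $ j = of_real (d i) * W $ i $ j"
  unfolding real_diagonal_def matrix_matrix_mult_def
  by (simp add: mult_delta_left)

lemma real_diagonal_mult_right:
  "(W ** real_diagonal d) $ i $ j = W $ i $ j * of_real (d j)"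
  unfolding real_diagonal_def matrix_matrix_mult_def
  by (simp add: mult_delta_right)

lemma hermitian_fun_unique:
  fixes U V :: "complex^'n^'n"
  assumes U: "unitary U" and V: "unitary V"
    and eq: "U ** real_diagonal d ** conj_transpose U = V ** real_diagonal e ** conj_transpose V"
  shows "U ** real_diagonal (\<lambda>i. g (d i)) ** conj_transpose U =
         V ** real_diagonal (\<lambda>i. g (e i)) ** conj_transpose V"
proof -
  define W where "W = conj_transpose V ** U"
  have [simp]: "conj_transpose U ** U = mat 1" "V ** conj_transpose V = mat 1"
    "U ** conj_transpose U = mat 1" "conj_transpose V ** V = mat 1"
    using U V by (simp_all add: unitary_def)
  have [simp]: "V ** (conj_transpose V ** X) = X" "conj_transpose V ** (V ** X) = X" for X :: "complex^'n^'n"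
    by (simp_all add: matrix_mul_assoc)
  have "W ** real_diagonal d =
        conj_transpose V ** (U ** real_diagonal d ** conj_transpose U) ** U"
    by (simp add: W_def flip: matrix_mul_assoc)
  also have "\<dots> = conj_transpose V ** (V ** real_diagonal e ** conj_transpose V) ** U"
    by (simp add: eq)
  also have "\<dots> = real_diagonal e ** W"
    by (simp add: W_def flip: matrix_mul_assoc)
  finally have comm: "W ** real_diagonal d = real_diagonal e ** W" .
  have "W $ i $ j * of_real (g (d j)) = of_real (g (e i)) * W $ i $ j" for i j
  proof -
    have "W $ i $ j * of_real (d j) = of_real (e i) * W $ i $ j"
      using arg_cong [OF comm, of "\<lambda>M. M $ i $ j"]
      by (simp only: real_diagonal_mult_left real_diagonal_mult_right)
    then have "W $ i $ j = 0 \<or> d j = e i"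
      by (simp add: mult.commute)
    then show ?thesis
      by auto
  qed
  then have comm': "W ** real_diagonal (\<lambda>i. g (d i)) = real_diagonal (\<lambda>i. g (e i)) ** W"
    by (simp add: vec_eq_iff real_diagonal_mult_left real_diagonal_mult_right)
  have "U ** real_diagonal (\<lambda>i. g (d i)) ** conj_transpose U =
        V ** (W ** real_diagonal (\<lambda>i. g (d i))) ** conj_transpose U"
    by (simp add: W_def flip: matrix_mul_assoc)
  also have "\<dots> = V ** (real_diagonal (\<lambda>i. g (e i)) ** W) ** conj_transpose U"
    by (simp add: comm')
  also have "\<dots> = V ** real_diagonal (\<lambda>i. g (e i)) ** conj_transpose V"
    by (simp add: W_def flip: matrix_mul_assoc)
  finally show ?thesis .
qed

lemma hermitian_fun_diagonalization:
  assumes "unitary U"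
  shows "hermitian_fun g (U ** real_diagonal d ** conj_transpose U) =
         U ** real_diagonal (\<lambda>i. g (d i)) ** conj_transpose U"
  unfolding hermitian_fun_def
proof (rule the_equality)
  show "\<exists>V e. unitary V \<and>
          U ** real_diagonal d ** conj_transpose U = V ** real_diagonal e ** conj_transpose V \<and>
          U ** real_diagonal (\<lambda>i. g (d i)) ** conj_transpose U =
          V ** real_diagonal (\<lambda>i. g (e i)) ** conj_transpose V"
    using assms by (intro exI [of _ U] exI [of _ d]) simp
next
  fix X
  assume "\<exists>V e. unitary V \<and>
          U ** real_diagonal d ** conj_transpose U = V ** real_diagonal e ** conj_transpose V \<and>
          X = V ** real_diagonal (\<lambda>i. g (e i)) ** conj_transpose V"
  then obtain V e where V: "unitary V"
      "U ** real_diagonal d ** conj_transpose U = V ** real_diagonal e ** conj_transpose V"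
    and X: "X = V ** real_diagonal (\<lambda>i. g (e i)) ** conj_transpose V"
    by auto
  show "X = U ** real_diagonal (\<lambda>i. g (d i)) ** conj_transpose U"
    using hermitian_fun_unique [OF assms V] X by simp
qed

end

theory Submission
  imports Defs
begin

text \<open>
  Commuting positive semidefinite matrices have a common unitary diagonalization, with
  eigenvalues \<open>a\<^sub>i, b\<^sub>i \<ge> 0\<close>. Each \<open>a\<^sub>i powr p\<close> is at most \<open>tr (A\<^sup>p) < R\<close>, and likewise for \<open>B\<close>,
  so all series converge absolutely and the claim becomes Hoelder's inequality for the double
  sum over \<open>i\<close> and \<open>k\<close> with weights \<open>\<bar>\<alpha>\<^sub>k\<bar>\<close>.
\<close>

section \<open>Young's and Hoelder's inequalities for power series\<close>

lemma powr_power_nat: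
  fixes x p :: real
  assumes "0 \<le> x"
  shows "(x ^ k) powr p = (x powr p) ^ k"
proof (cases "x = 0")
  case True
  then show ?thesis
    \<comment> \<open>Since \<open>0 powr p = 0\<close> for every \<open>p\<close>, both sides are 1
      for \<open>k = 0\<close> and 0 otherwise.\<close>
    by (cases k) auto
next
  case False
  then have "x > 0"
    using assms by simp
  then show ?thesis
    by (simp add: powr_def ln_realpow exp_of_nat_mult[symmetric] mult_ac)
qed

lemma power_mult_le_Young:
  fixes x y p q :: real
  assumes "1 < p" "1 < q" "1 / p + 1 / q = 1" "0 \<le> x" "0 \<le> y"
  shows "(x * y) ^ k \<le> (x powr p) ^ k / p + (y powr q) ^ k / q"
  using Youngs_inequality[OF assms(1-3), of "x ^ k" "y ^ k"] assms(4,5)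
  by (simp add: powr_power_nat power_mult_distrib)

text \<open>Termwise Young provides the majorant, so convergence passes from \<open>x powr p\<close>
  and \<open>y powr q\<close> to the product \<open>x * y\<close> without reference to a radius of
  convergence.\<close>

lemma summable_power_mult:
  fixes c :: "nat \<Rightarrow> real" and x y p q :: real
  assumes "1 < p" "1 < q" "1 / p + 1 / q = 1" "0 \<le> x" "0 \<le> y"
    and c: "\<And>k. 0 \<le> c k"
    and "summable (\<lambda>k. c k * (x powr p) ^ k)"
    and "summable (\<lambda>k. c k * (y powr q) ^ k)"
  shows "summable (\<lambda>k. c k * (x * y) ^ k)"
proof (rule summable_comparison_test')
  show "summable (\<lambda>k. c k * (x powr p) ^ k / p + c k * (y powr q) ^ k / q)"
    using assms by (intro summable_add summable_divide)
  fix k :: nat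
  show "norm (c k * (x * y) ^ k) \<le> c k * (x powr p) ^ k / p + c k * (y powr q) ^ k / q"
    using mult_left_mono[OF power_mult_le_Young[OF assms(1-5), of k] c[of k]] c[of k] assms(4,5)
    by (simp add: distrib_left)
qed

text \<open>Hoelder's inequality over the pairs of \<open>i\<close> and \<open>k\<close> with
  weights \<open>c k\<close>, by normalisation: once both factors are divided by their norms,
  Young's inequality applies termwise and its right-hand sides sum to
  \<open>1 / p + 1 / q = 1\<close>. A zero norm is treated separately.\<close>

lemma Hoelder_power_series:
  fixes c :: "nat \<Rightarrow> real" and a b :: "'i \<Rightarrow> real" and p q :: real
  assumes I: "finite I" and pq: "1 < p" "1 < q" "1 / p + 1 / q = 1"
    and a: "\<And>i. i \<in> I \<Longrightarrow> 0 \<le> a i" and b: "\<And>i. i \<in> I \<Longrightarrow> 0 \<le> b i"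
    and c: "\<And>k. 0 \<le> c k"
    and sa: "\<And>i. i \<in> I \<Longrightarrow> summable (\<lambda>k. c k * (a i powr p) ^ k)"
    and sb: "\<And>i. i \<in> I \<Longrightarrow> summable (\<lambda>k. c k * (b i powr q) ^ k)"
  shows "(\<Sum>i\<in>I. \<Sum>k. c k * (a i * b i) ^ k)
       \<le> (\<Sum>i\<in>I. \<Sum>k. c k * (a i powr p) ^ k) powr (1 / p)
         * (\<Sum>i\<in>I. \<Sum>k. c k * (b i powr q) ^ k) powr (1 / q)"
proof -
  define X where "X = (\<Sum>i\<in>I. \<Sum>k. c k * (a i powr p) ^ k)"
  define Y where "Y = (\<Sum>i\<in>I. \<Sum>k. c k * (b i powr q) ^ k)"
  \<comment> \<open>For the degenerate cases: nonnegativity forces first each inner series and then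
    each of its terms to be zero.\<close>
  have vanish: "c k * (w i) ^ k = 0"
    if "(\<Sum>i\<in>I. \<Sum>k. c k * (w i) ^ k) = 0" "\<And>i. i \<in> I \<Longrightarrow> summable (\<lambda>k. c k * (w i) ^ k)"
      "\<And>i. i \<in> I \<Longrightarrow> 0 \<le> w i" "i \<in> I" for w :: "'i \<Rightarrow> real" and i k
  proof -
    have "(\<Sum>k. c k * (w i) ^ k) = 0"
      using that c I by (subst (asm) sum_nonneg_eq_0_iff) (auto intro!: suminf_nonneg)
    then show ?thesis
      using that c by (subst (asm) suminf_eq_zero_iff) auto
  qed
  have "X \<ge> 0" "Y \<ge> 0"
    unfolding X_def Y_def using sa sb c by (auto intro!: sum_nonneg suminf_nonneg)
  consider "X = 0" | "Y = 0" | "X > 0" "Y > 0"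
    using \<open>X \<ge> 0\<close> \<open>Y \<ge> 0\<close> by linarith
  then have "(\<Sum>i\<in>I. \<Sum>k. c k * (a i * b i) ^ k) \<le> X powr (1 / p) * Y powr (1 / q)"
  proof cases
    case 1
    then have "c k * (a i powr p) ^ k = 0" if "i \<in> I" for i k
      using vanish[of "\<lambda>i. a i powr p"] sa that by (auto simp: X_def)
    \<comment> \<open>Either \<open>c k = 0\<close>, or \<open>a i = 0\<close> and
      \<open>k > 0\<close>; the product term vanishes in both cases.\<close>
    then have "c k * (a i * b i) ^ k = 0" if "i \<in> I" for i k
      using that by (fastforce simp: power_mult_distrib)
    then have "(\<Sum>i\<in>I. \<Sum>k. c k * (a i * b i) ^ k) = 0"
      by (intro sum.neutral ballI) (simp only: suminf_zero)
    then show ?thesis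
      by simp
  next
    case 2
    then have "c k * (b i powr q) ^ k = 0" if "i \<in> I" for i k
      using vanish[of "\<lambda>i. b i powr q"] sb that by (auto simp: Y_def)
    then have "c k * (a i * b i) ^ k = 0" if "i \<in> I" for i k
      using that by (fastforce simp: power_mult_distrib)
    then have "(\<Sum>i\<in>I. \<Sum>k. c k * (a i * b i) ^ k) = 0"
      by (intro sum.neutral ballI) (simp only: suminf_zero)
    then show ?thesis
      by simp
  next
    case 3
    \<comment> \<open>\<open>s\<close> and \<open>t\<close> are the weighted p- and q-norms of the
      families \<open>a i ^ k\<close> and \<open>b i ^ k\<close>, so the quotients
      \<open>a i ^ k / s\<close> and \<open>b i ^ k / t\<close> have norm 1.\<close>
    define s where "s = X powr (1 / p)"
    define t where "t = Y powr (1 / q)"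
    have st: "s > 0" "t > 0" "s powr p = X" "t powr q = Y"
      using 3 pq by (auto simp: s_def t_def powr_powr)
    have le: "c k * (a i * b i) ^ k
        \<le> s * t * (c k * (a i powr p) ^ k / (p * X) + c k * (b i powr q) ^ k / (q * Y))"
      if "i \<in> I" for i k
    proof -
      have "(a i ^ k / s) * (b i ^ k / t) \<le> (a i ^ k / s) powr p / p + (b i ^ k / t) powr q / q"
        using a[OF that] b[OF that] st by (intro Youngs_inequality pq) auto
      also have "\<dots> = (a i powr p) ^ k / (p * X) + (b i powr q) ^ k / (q * Y)"
        using a[OF that] b[OF that] st by (simp add: powr_divide powr_power_nat mult.commute)
      finally have "(a i * b i) ^ k \<le> s * t * ((a i powr p) ^ k / (p * X) + (b i powr q) ^ k / (q * Y))"
        using st by (simp add: power_mult_distrib pos_divide_le_eq mult_ac)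
      from mult_left_mono[OF this c[of k]] show ?thesis
        by (simp add: distrib_left mult.left_commute[of "c k"])
    qed
    have lim: "(\<lambda>k. s * t * (c k * (a i powr p) ^ k / (p * X) + c k * (b i powr q) ^ k / (q * Y)))
        sums (s * t * ((\<Sum>k. c k * (a i powr p) ^ k) / (p * X) + (\<Sum>k. c k * (b i powr q) ^ k) / (q * Y)))"
      if "i \<in> I" for i
      using sa[OF that] sb[OF that] by (intro sums_mult sums_add sums_divide summable_sums)
    have "(\<Sum>k. c k * (a i * b i) ^ k)
        \<le> s * t * ((\<Sum>k. c k * (a i powr p) ^ k) / (p * X) + (\<Sum>k. c k * (b i powr q) ^ k) / (q * Y))"
      if "i \<in> I" for i
      by (rule sums_le[OF le[OF that] summable_sums lim[OF that]])
         (rule summable_power_mult[OF pq a[OF that] b[OF that] c sa[OF that] sb[OF that]])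
    then have "(\<Sum>i\<in>I. \<Sum>k. c k * (a i * b i) ^ k)
        \<le> (\<Sum>i\<in>I. s * t * ((\<Sum>k. c k * (a i powr p) ^ k) / (p * X) + (\<Sum>k. c k * (b i powr q) ^ k) / (q * Y)))"
      by (rule sum_mono)
    also have "\<dots> = s * t * (X / (p * X) + Y / (q * Y))"
      by (simp add: X_def Y_def sum.distrib flip: sum_distrib_left sum_divide_distrib)
    also have "\<dots> = s * t"
      using 3 pq by simp
    finally show ?thesis
      by (simp add: s_def t_def)
  qed
  then show ?thesis
    by (simp add: X_def Y_def)
qed

section \<open>Eigenvectors of commuting self-adjoint maps\<close>

text \<open>A maximiser of the Rayleigh quotient on \<open>W\<close> is an eigenvector, because the form
  \<open>l * (v \<bullet> v) - v \<bullet> f v\<close> is nonnegative on \<open>W\<close> and vanishes at it.\<close>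

lemma selfadjoint_eigenvector_in_subspace:
  fixes f :: "'a::euclidean_space \<Rightarrow> 'a"
  assumes f: "linear f" and sa: "\<And>x y. x \<bullet> f y = f x \<bullet> y"
    and W: "subspace W" and inv: "\<And>x. x \<in> W \<Longrightarrow> f x \<in> W" and ne: "\<exists>x\<in>W. x \<noteq> 0"
  obtains x l where "x \<in> W" "x \<noteq> 0" "f x = l *\<^sub>R x"
proof -
  define S where "S = W \<inter> sphere 0 1"
  have "compact S"
    unfolding S_def by (intro closed_Int_compact closed_subspace W compact_sphere)
  obtain w where w: "w \<in> W" "w \<noteq> 0"
    using ne by auto
  then have "w /\<^sub>R norm w \<in> S"
    by (simp add: S_def subspace_scale[OF W])
  moreover have "continuous_on S (\<lambda>x. x \<bullet> f x)"
    using f by (intro continuous_intros linear_continuous_on) (simp add: linear_conv_bounded_linear)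
  ultimately obtain x where x: "x \<in> S" and max: "\<And>y. y \<in> S \<Longrightarrow> y \<bullet> f y \<le> x \<bullet> f x"
    using continuous_attains_sup[OF \<open>compact S\<close>] by blast
  define l where "l = x \<bullet> f x"
  have xW: "x \<in> W" and x1: "norm x = 1"
    using x by (auto simp: S_def)
  have nonneg: "0 \<le> l * (v \<bullet> v) - v \<bullet> f v" if "v \<in> W" for v
  proof (cases "v = 0")
    case False
    have "(v /\<^sub>R norm v) \<bullet> f (v /\<^sub>R norm v) \<le> l"
      unfolding l_def using False that by (intro max) (simp add: S_def subspace_scale[OF W])
    then have "(v \<bullet> f v) / (norm v)\<^sup>2 \<le> l"
      using f by (simp add: linear_cmul power2_eq_square divide_inverse mult_ac)
    then show ?thesis
      using False by (simp add: pos_divide_le_eq power2_norm_eq_inner)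
  qed (simp add: linear_0[OF f])
  \<comment> \<open>The residual of the eigenvalue equation, to be shown zero. The maximiser is
    perturbed in this very direction, which turns the first-order term of the form into
    \<open>- 2 * t * (y \<bullet> y)\<close>.\<close>
  define y where "y = f x - l *\<^sub>R x"
  define M where "M = l * (y \<bullet> y) - y \<bullet> f y"
  have yW: "y \<in> W"
    unfolding y_def by (intro subspace_diff subspace_scale W inv xW)
  have quadratic: "0 \<le> t\<^sup>2 * M - 2 * t * (y \<bullet> y)" for t
  proof -
    have "0 \<le> l * ((x + t *\<^sub>R y) \<bullet> (x + t *\<^sub>R y)) - (x + t *\<^sub>R y) \<bullet> f (x + t *\<^sub>R y)"
      by (intro nonneg subspace_add subspace_scale W xW yW)
    also have "\<dots> = t\<^sup>2 * M - 2 * t * (y \<bullet> (f x - l *\<^sub>R x))"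
      using x1 sa[of x y]
      by (simp add: M_def linear_add[OF f] linear_cmul[OF f] inner_simps inner_commute
          power2_eq_square algebra_simps l_def norm_eq_1)
    finally show ?thesis
      by (simp add: y_def)
  qed
  have "y \<bullet> y = 0"
  proof (rule ccontr)
    assume "y \<bullet> y \<noteq> 0"
    then have pos: "y \<bullet> y > 0"
      by simp
    \<comment> \<open>So small that \<open>t * M\<close> is at most \<open>y \<bullet> y\<close>,
      whereas nonnegativity of the form would require \<open>2 * (y \<bullet> y)\<close>. The
      summand 1 keeps the denominator positive when \<open>M = 0\<close>.\<close>
    define t where "t = (y \<bullet> y) / (\<bar>M\<bar> + 1)"
    have "t > 0"
      using pos by (simp add: t_def add_nonneg_pos)
    then have "2 * (y \<bullet> y) \<le> t * M"
      using quadratic[of t] by (simp add: power2_eq_square)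
    also have "\<dots> \<le> t * (\<bar>M\<bar> + 1)"
      using \<open>t > 0\<close> by (intro mult_left_mono) auto
    also have "\<dots> = y \<bullet> y"
      by (simp add: t_def)
    finally show False
      using pos by simp
  qed
  then have "f x = l *\<^sub>R x"
    by (simp add: y_def)
  moreover have "x \<noteq> 0"
    using x1 by auto
  ultimately show thesis
    using that xW by blast
qed

text \<open>Since the maps commute, an eigenspace of \<open>f\<close> inside \<open>W\<close> is
  invariant under \<open>g\<close>. An eigenvector of \<open>g\<close> found there is a joint
  one.\<close>

lemma commuting_selfadjoint_eigenvector_in_subspace:
  fixes f g :: "'a::euclidean_space \<Rightarrow> 'a"
  assumes f: "linear f" "\<And>x y. x \<bullet> f y = f x \<bullet> y" "\<And>x. x \<in> W \<Longrightarrow> f x \<in> W"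
    and g: "linear g" "\<And>x y. x \<bullet> g y = g x \<bullet> y" "\<And>x. x \<in> W \<Longrightarrow> g x \<in> W"
    and comm: "\<And>x. f (g x) = g (f x)"
    and W: "subspace W" and ne: "\<exists>x\<in>W. x \<noteq> 0"
  obtains x l m where "x \<in> W" "x \<noteq> 0" "f x = l *\<^sub>R x" "g x = m *\<^sub>R x"
proof -
  obtain w l where w: "w \<in> W" "w \<noteq> 0" "f w = l *\<^sub>R w"
    using selfadjoint_eigenvector_in_subspace[OF f(1,2) W f(3) ne] by blast
  define V where "V = {x \<in> W. f x = l *\<^sub>R x}"
  have "subspace V"
    using W f(1) by (auto simp: V_def subspace_def linear_0 linear_add linear_cmul scaleR_add_right)
  moreover have "g x \<in> V" if "x \<in> V" for x
    using that by (simp add: V_def g(3) comm linear_cmul[OF g(1)])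
  moreover have "\<exists>x\<in>V. x \<noteq> 0"
    using w by (auto simp: V_def)
  ultimately obtain x m where "x \<in> V" "x \<noteq> 0" "g x = m *\<^sub>R x"
    using selfadjoint_eigenvector_in_subspace[OF g(1,2)] by blast
  then show thesis
    using that by (auto simp: V_def)
qed

section \<open>The complex inner product\<close>

text \<open>The real inner product on \<open>complex^'n\<close> is the real part of this form. The
  real part suffices for finding eigenvectors, because the eigenvalues are real; unitarity needs the
  whole form.\<close>

definition cinner :: "complex^'n \<Rightarrow> complex^'n \<Rightarrow> complex" where
  "cinner x y = (\<Sum>i\<in>UNIV. cnj (x $ i) * y $ i)"

lemma cinner_commute: "cinner y x = cnj (cinner x y)"
  by (simp add: cinner_def mult.commute)

lemma Re_cinner: "Re (cinner x y) = x \<bullet> y"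
  by (simp add: cinner_def inner_vec_def inner_complex_def)

lemma cinner_self: "cinner x x = of_real (x \<bullet> x)"
  by (simp add: complex_eq_iff Re_cinner) (simp add: cinner_def)

lemma cinner_add_right: "cinner x (y + z) = cinner x y + cinner x z"
  by (simp add: cinner_def distrib_left sum.distrib)

lemma cinner_scaleR_right: "cinner x (r *\<^sub>R y) = of_real r * cinner x y"
  by (simp add: cinner_def sum_distrib_left scaleR_conv_of_real[where 'a=complex] mult_ac)

lemma cinner_scaleR_left: "cinner (r *\<^sub>R x) y = of_real r * cinner x y"
  by (simp add: cinner_def sum_distrib_left scaleR_conv_of_real[where 'a=complex] mult_ac)

lemma cinner_conj_transpose: "cinner x (A *v y) = cinner (conj_transpose A *v x) y"
proof -
  have "cinner x (A *v y) = (\<Sum>i\<in>UNIV. \<Sum>j\<in>UNIV. cnj (x $ i) * (A $ i $ j * y $ j))"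
    by (simp add: cinner_def matrix_vector_mult_def sum_distrib_left)
  also have "\<dots> = (\<Sum>j\<in>UNIV. \<Sum>i\<in>UNIV. cnj (x $ i) * (A $ i $ j * y $ j))"
    by (rule sum.swap)
  also have "\<dots> = cinner (conj_transpose A *v x) y"
    by (simp add: cinner_def conj_transpose_def matrix_vector_mult_def sum_distrib_left sum_distrib_right mult_ac)
  finally show ?thesis .
qed

lemma linear_matrix_vector_mult: "linear ((*v) (A :: complex^'n^'m))"
  by (auto intro!: linearI simp: matrix_vector_right_distrib vec_eq_iff matrix_vector_mult_def
      scaleR_right.sum)

lemma cinner_hermitian: "hermitian A \<Longrightarrow> cinner x (A *v y) = cinner (A *v x) y"
  by (simp add: cinner_conj_transpose hermitian_def)

section \<open>Simultaneous unitary diagonalization\<close>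

text \<open>Orthogonality to the \<open>u j\<close> is a square system with a zero row at \<open>i\<close>, hence singular;
  this spares any dimension count.\<close>

lemma exists_nonzero_cinner_orthogonal:
  fixes u :: "'n \<Rightarrow> complex^'n"
  assumes "i \<notin> J"
  shows "\<exists>x. x \<noteq> 0 \<and> (\<forall>j\<in>J. cinner (u j) x = 0)"
proof -
  define M :: "complex^'n^'n" where "M = (\<chi> j k. if j \<in> J then cnj (u j $ k) else 0)"
  have "row i M = 0"
    using assms by (simp add: M_def row_def vec_eq_iff)
  then have "\<not> invertible M"
    by (simp add: invertible_det_nz det_zero_row)
  then obtain x where x: "M *v x = 0" "x \<noteq> 0"
    by (auto simp: invertible_left_inverse matrix_left_invertible_ker)
  have "cinner (u j) x = (M *v x) $ j" if "j \<in> J" for j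
    using that by (simp add: M_def matrix_vector_mult_def cinner_def)
  then show ?thesis
    using x by auto
qed

text \<open>Induction on \<open>J\<close>: as \<open>A\<close> and \<open>B\<close> are Hermitian,
  they preserve the orthogonal complement of the joint eigenvectors found so far, which therefore
  contains another one. Indexing by subsets of \<open>'n\<close> makes the family for
  \<open>J = UNIV\<close> ready to serve as the columns of a square matrix.\<close>

lemma commuting_hermitian_orthonormal_eigenvectors:
  fixes A B :: "complex^'n^'n" and J :: "'n set"
  assumes A: "hermitian A" and B: "hermitian B" and comm: "A ** B = B ** A"
  shows "\<exists>u l m. (\<forall>i\<in>J. \<forall>j\<in>J. cinner (u i) (u j) = (if i = j then 1 else 0)) \<and>
           (\<forall>j\<in>J. A *v u j = l j *\<^sub>R u j \<and> B *v u j = m j *\<^sub>R u j)"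
  using finite[of J]
proof (induction J)
  case (insert i J)
  then obtain u l m where
    u: "\<And>i j. i \<in> J \<Longrightarrow> j \<in> J \<Longrightarrow> cinner (u i) (u j) = (if i = j then 1 else 0)"
    and ul: "\<And>j. j \<in> J \<Longrightarrow> A *v u j = l j *\<^sub>R u j"
    and um: "\<And>j. j \<in> J \<Longrightarrow> B *v u j = m j *\<^sub>R u j"
    by blast
  \<comment> \<open>Orthogonality is meant in the complex sense, although \<open>W\<close> is used
    only as a real subspace: the new vector must be orthogonal for \<open>cinner\<close>, not merely
    for its real part.\<close>
  define W where "W = {x. \<forall>j\<in>J. cinner (u j) x = 0}"
  have W: "subspace W"
    by (auto simp: W_def subspace_def cinner_add_right cinner_scaleR_right) (simp add: cinner_def)
  have ne: "\<exists>x\<in>W. x \<noteq> 0"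
    using exists_nonzero_cinner_orthogonal[OF insert.hyps(2), of u] by (auto simp: W_def)
  have inv: "A *v x \<in> W" "B *v x \<in> W" if "x \<in> W" for x
    using that by (simp_all add: W_def cinner_hermitian A B ul um cinner_scaleR_left)
  have sym: "x \<bullet> (A *v y) = (A *v x) \<bullet> y" "x \<bullet> (B *v y) = (B *v x) \<bullet> y" for x y
    by (simp_all add: cinner_hermitian A B flip: Re_cinner)
  have comm': "A *v (B *v x) = B *v (A *v x)" for x
    by (simp add: matrix_vector_mul_assoc comm)
  obtain x a b where
    x: "x \<in> W" "x \<noteq> 0" and xa: "A *v x = a *\<^sub>R x" and xb: "B *v x = b *\<^sub>R x"
    using commuting_selfadjoint_eigenvector_in_subspace
      [OF linear_matrix_vector_mult sym(1) inv(1) linear_matrix_vector_mult sym(2) inv(2) comm' W ne]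
    by blast
  define y where "y = x /\<^sub>R norm x"
  have y: "cinner y y = 1" "A *v y = a *\<^sub>R y" "B *v y = b *\<^sub>R y"
    using x xa xb
    by (simp_all add: y_def cinner_self linear_cmul[OF linear_matrix_vector_mult] dot_square_norm
        power2_eq_square)
  have ort: "cinner (u j) y = 0" "cinner y (u j) = 0" if "j \<in> J" for j
  proof -
    show "cinner (u j) y = 0"
      using x that by (simp add: y_def cinner_scaleR_right W_def)
    then show "cinner y (u j) = 0"
      by (simp add: cinner_commute[of y "u j"])
  qed
  have "i \<notin> J" by fact
  then show ?case
    using u ul um y ort
    by (intro exI[of _ "u(i := y)"] exI[of _ "l(i := a)"] exI[of _ "m(i := b)"])
       (auto simp: fun_upd_def)
qed auto

text \<open>With the joint eigenvectors as columns of \<open>U\<close>, orthonormality says that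
  \<open>U\<close> is unitary, and the eigenvalue equations say
  \<open>C ** U = U ** real_diagonal h\<close> for \<open>C\<close> either of the two
  matrices.\<close>

lemma commuting_hermitian_diagonalization:
  fixes A B :: "complex^'n^'n"
  assumes "hermitian A" "hermitian B" "A ** B = B ** A"
  obtains U d e where "unitary U"
    "A = U ** real_diagonal d ** conj_transpose U"
    "B = U ** real_diagonal e ** conj_transpose U"
proof -
  obtain u :: "'n \<Rightarrow> complex^'n" and d e where
    u: "\<And>i j. cinner (u i) (u j) = (if i = j then 1 else 0)"
    and ud: "\<And>j. A *v u j = d j *\<^sub>R u j" and ue: "\<And>j. B *v u j = e j *\<^sub>R u j"
    using commuting_hermitian_orthonormal_eigenvectors[OF assms, of UNIV] by blast
  define U :: "complex^'n^'n" where "U = (\<chi> k j. u j $ k)"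
  have "conj_transpose U ** U = mat 1"
    using u by (simp add: vec_eq_iff matrix_matrix_mult_def conj_transpose_def U_def mat_def cinner_def)
  then have U: "unitary U"
    by (simp add: unitary_def matrix_left_right_inverse)
  have "C = U ** real_diagonal h ** conj_transpose U" if "\<And>j. C *v u j = h j *\<^sub>R u j" for C h
  proof -
    have "(C ** U) $ k $ j = (U ** real_diagonal h) $ k $ j" for k j
    proof -
      have "(C ** U) $ k $ j = (C *v u j) $ k"
        by (simp add: matrix_matrix_mult_def matrix_vector_mult_def U_def)
      then show ?thesis
        by (simp add: that real_diagonal_mult_right U_def scaleR_conv_of_real[where 'a=complex] mult.commute)
    qed
    then have "C ** U = U ** real_diagonal h"
      by (simp add: vec_eq_iff)
    then have "C ** (U ** conj_transpose U) = U ** real_diagonal h ** conj_transpose U"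
      by (simp add: matrix_mul_assoc)
    then show ?thesis
      using U by (simp add: unitary_def)
  qed
  then show thesis
    using that U ud ue by blast
qed

section \<open>Powers, traces and series of diagonalized matrices\<close>

text \<open>Column \<open>j\<close> of \<open>U\<close> is a unit eigenvector, and the quadratic
  form takes the value \<open>d j\<close> at it.\<close>

lemma positive_semidefinite_eigenvalue_nonneg:
  assumes U: "unitary U" and "positive_semidefinite (U ** real_diagonal d ** conj_transpose U)"
  shows "0 \<le> d j"
proof -
  let ?A = "U ** real_diagonal d ** conj_transpose U"
  have "?A ** U = U ** real_diagonal d"
    using U by (simp add: unitary_def flip: matrix_mul_assoc)
  then have "(?A ** U) $ k $ j = U $ k $ j * of_real (d j)" for k
    by (simp only: real_diagonal_mult_right)
  then have *: "(?A *v column j U) $ k = U $ k $ j * of_real (d j)" for k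
    by (simp add: matrix_matrix_mult_def matrix_vector_mult_def column_def)
  have "(conj_transpose U ** U) $ j $ j = 1"
    using U by (simp add: unitary_def mat_def)
  then have norm1: "(\<Sum>k\<in>UNIV. cnj (U $ k $ j) * U $ k $ j) = 1"
    by (simp add: matrix_matrix_mult_def conj_transpose_def)
  have "quadratic_form ?A (column j U) = (\<Sum>k\<in>UNIV. cnj (U $ k $ j) * (U $ k $ j * of_real (d j)))"
    unfolding quadratic_form_def * by (simp add: column_def)
  also have "\<dots> = (\<Sum>k\<in>UNIV. cnj (U $ k $ j) * U $ k $ j) * of_real (d j)"
    by (simp add: sum_distrib_left mult_ac)
  finally have "quadratic_form ?A (column j U) = of_real (d j)"
    by (simp add: norm1)
  then show ?thesis
    using assms(2) unfolding positive_semidefinite_def by (metis Re_complex_of_real)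
qed

lemma unitary_diagonal_mult:
  fixes U :: "complex^'n^'n"
  assumes "unitary U"
  shows "(U ** real_diagonal d ** conj_transpose U) ** (U ** real_diagonal e ** conj_transpose U)
       = U ** real_diagonal (\<lambda>i. d i * e i) ** conj_transpose U"
proof -
  have "real_diagonal d ** real_diagonal e = real_diagonal (\<lambda>i. d i * e i)"
    by (simp add: vec_eq_iff real_diagonal_mult_left) (simp add: real_diagonal_def)
  moreover have "conj_transpose U ** (U ** X) = X" for X :: "complex^'n^'n"
    using assms by (simp add: unitary_def matrix_mul_assoc)
  moreover have "real_diagonal d ** (real_diagonal e ** X) = real_diagonal d ** real_diagonal e ** X"
    for X :: "complex^'n^'n"
    by (rule matrix_mul_assoc)
  ultimately show ?thesis
    by (simp flip: matrix_mul_assoc)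
qed

lemma matrix_power_unitary_diagonal:
  fixes U :: "complex^'n^'n"
  assumes "unitary U"
  shows "matrix_power (U ** real_diagonal d ** conj_transpose U) k
       = U ** real_diagonal (\<lambda>i. d i ^ k) ** conj_transpose U"
proof (induction k)
  case 0
  have "real_diagonal (\<lambda>i. 1) = (mat 1 :: complex^'n^'n)"
    by (simp add: real_diagonal_def mat_def vec_eq_iff)
  then show ?case
    using assms by (simp add: unitary_def)
qed (simp add: unitary_diagonal_mult assms)

lemma trace_unitary_diagonal:
  fixes U :: "complex^'n^'n"
  assumes "unitary U"
  shows "trace (U ** real_diagonal d ** conj_transpose U) = (\<Sum>i\<in>UNIV. of_real (d i))"
proof -
  have "trace (U ** real_diagonal d ** conj_transpose U)
      = trace (conj_transpose U ** (U ** real_diagonal d))"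
    by (rule trace_mul_sym)
  also have "\<dots> = trace (real_diagonal d :: complex^'n^'n)"
    using assms by (simp add: unitary_def matrix_mul_assoc)
  finally show ?thesis
    by (simp add: trace_def real_diagonal_def)
qed

text \<open>Each entry of the partial sums is a fixed linear combination of partial sums of the
  scalar series at the eigenvalues. So the matrix series converges entrywise, and the trace may be
  taken term by term.\<close>

lemma trace_matrix_series_unitary_diagonal:
  assumes U: "unitary U" and s: "\<And>i. summable (\<lambda>k. c k * of_real (d i) ^ k)"
  shows "trace (matrix_series c (U ** real_diagonal d ** conj_transpose U))
       = (\<Sum>i\<in>UNIV. \<Sum>k. c k * of_real (d i) ^ k)"
proof -
  define T where "T = U ** real_diagonal d ** conj_transpose U"
  define M where "M k = (\<chi> i j. c k * matrix_power T k $ i $ j)" for k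
  have entry: "M k $ i $ j = (\<Sum>l\<in>UNIV. U $ i $ l * (c k * of_real (d l) ^ k) * cnj (U $ j $ l))"
    for k i j
    unfolding M_def T_def matrix_power_unitary_diagonal[OF U]
    by (simp add: matrix_matrix_mult_def[of "_ ** _"] real_diagonal_mult_right conj_transpose_def
        sum_distrib_left mult_ac)
  \<comment> \<open>Convergence comes first, because the infinite sum in
    \<open>matrix_series\<close> has an unspecified value otherwise.\<close>
  have "summable (\<lambda>k. M k $ i $ j)" for i j
    unfolding entry by (intro summable_sum summable_mult summable_mult2 s)
  then have "M sums (\<chi> i j. \<Sum>k. M k $ i $ j)"
    unfolding sums_def
    by (intro vec_tendstoI) (simp add: summable_LIMSEQ)
  then have "(\<lambda>k. M k) sums matrix_series c T"
    by (simp add: matrix_series_def M_def[abs_def] sums_iff)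
  then have "(\<lambda>k. trace (M k)) sums trace (matrix_series c T)"
    unfolding trace_def by (intro sums_sum sums_vec_nth)
  moreover have "trace (M k) = (\<Sum>i\<in>UNIV. c k * of_real (d i) ^ k)" for k
  proof -
    have "trace (M k) = c k * trace (matrix_power T k)"
      by (simp add: M_def trace_def sum_distrib_left)
    then show ?thesis
      by (simp add: T_def matrix_power_unitary_diagonal[OF U] trace_unitary_diagonal[OF U]
          sum_distrib_left)
  qed
  moreover have "(\<lambda>k. \<Sum>i\<in>UNIV. c k * of_real (d i) ^ k)
      sums (\<Sum>i\<in>UNIV. \<Sum>k. c k * of_real (d i) ^ k)"
    by (intro sums_sum summable_sums s)
  ultimately show ?thesis
    by (simp add: T_def sums_iff)
qed

section \<open>The trace inequality\<close>

text \<open>Convergence at a real \<open>r\<close> strictly between \<open>t\<close> and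
  \<open>R\<close> gives absolute convergence at the smaller \<open>t\<close>. Such an
  \<open>r\<close> exists also for \<open>R = \<infinity>\<close>.\<close>

lemma power_series_abs_summable:
  fixes \<alpha> :: "nat \<Rightarrow> complex" and R :: ereal
  assumes s: "\<And>z. z \<in> eball 0 R \<Longrightarrow> summable (\<lambda>k. \<alpha> k * z ^ k)"
    and t: "0 \<le> t" "ereal t < R"
  shows "summable (\<lambda>k. cmod (\<alpha> k) * t ^ k)"
proof -
  obtain r where r: "ereal t < ereal r" "ereal r < R"
    using t(2) ereal_dense2 by blast
  have "summable (\<lambda>k. \<alpha> k * of_real r ^ k)"
    using r t by (intro s) simp
  then have "summable (\<lambda>k. norm (\<alpha> k * of_real t ^ k))"
    using r t by (intro powser_insidea) auto
  then show ?thesis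
    using t by (simp add: norm_mult norm_power)
qed

theorem proposition7:
  fixes \<alpha> :: "nat \<Rightarrow> complex" and R :: ereal
    and A B :: "complex^'n^'n" and p q :: real
  assumes "0 < R"
    and "\<And>z. z \<in> eball 0 R \<Longrightarrow> summable (\<lambda>k. \<alpha> k * z ^ k)"
    and "positive_semidefinite A" and "positive_semidefinite B"
    and "A ** B = B ** A"
    and "1 < p" and "1 < q" and "1 / p + 1 / q = 1"
    and "ereal (Re (trace (psd_powr A p))) < R"
    and "ereal (Re (trace (psd_powr B q))) < R"
  shows "cmod (trace (matrix_series \<alpha> (A ** B)))
       \<le> Re (trace (matrix_series (\<lambda>k. of_real (cmod (\<alpha> k))) (psd_powr A p))) powr (1 / p)
         * Re (trace (matrix_series (\<lambda>k. of_real (cmod (\<alpha> k))) (psd_powr B q))) powr (1 / q)"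
proof -
  obtain U a b where U: "unitary U" and A: "A = U ** real_diagonal a ** conj_transpose U"
    and B: "B = U ** real_diagonal b ** conj_transpose U"
    using commuting_hermitian_diagonalization assms(3-5) unfolding positive_semidefinite_def by metis
  have a: "0 \<le> a i" and b: "0 \<le> b i" for i
    using positive_semidefinite_eigenvalue_nonneg[OF U] assms(3,4) A B by auto
  define c where "c k = cmod (\<alpha> k)" for k
  have c: "0 \<le> c k" for k
    by (simp add: c_def)
  \<comment> \<open>Stated for a generic \<open>D\<close> so that it serves both \<open>A\<close>
    with exponent \<open>p\<close> and \<open>B\<close> with exponent \<open>q\<close>.\<close>
  have summ: "summable (\<lambda>k. c k * (d i powr r) ^ k)"
    and series: "Re (trace (matrix_series (\<lambda>k. of_real (c k)) (psd_powr D r)))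
      = (\<Sum>i\<in>UNIV. \<Sum>k. c k * (d i powr r) ^ k)"
    if D: "D = U ** real_diagonal d ** conj_transpose U"
      and tr: "ereal (Re (trace (psd_powr D r))) < R" for D d r i
  proof -
    \<comment> \<open>The common \<open>U\<close> may be used here, as the functional calculus is
      independent of the diagonalization.\<close>
    have pow: "psd_powr D r = U ** real_diagonal (\<lambda>i. d i powr r) ** conj_transpose U"
      unfolding D psd_powr_def by (rule hermitian_fun_diagonalization[OF U])
    have "Re (trace (psd_powr D r)) = (\<Sum>i\<in>UNIV. d i powr r)"
      by (simp add: pow trace_unitary_diagonal[OF U])
    moreover have "d i powr r \<le> (\<Sum>i\<in>UNIV. d i powr r)" for i
      by (rule member_le_sum) auto
    ultimately have "ereal (d i powr r) < R" for i
      using tr by (metis ereal_less_eq(3) order.strict_trans1)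
    then have *: "summable (\<lambda>k. c k * (d i powr r) ^ k)" for i
      unfolding c_def by (intro power_series_abs_summable[OF assms(2)]) auto
    then show "summable (\<lambda>k. c k * (d i powr r) ^ k)" .
    have "summable (\<lambda>k. of_real (c k) * of_real (d i powr r) ^ k :: complex)" for i
      using summable_of_real[OF *[of i], where ?'a = complex] by simp
    then have "trace (matrix_series (\<lambda>k. of_real (c k)) (psd_powr D r))
        = (\<Sum>i\<in>UNIV. \<Sum>k. of_real (c k) * of_real (d i powr r) ^ k)"
      unfolding pow by (rule trace_matrix_series_unitary_diagonal[OF U])
    also have "\<dots> = of_real (\<Sum>i\<in>UNIV. \<Sum>k. c k * (d i powr r) ^ k)"
      by (simp add: suminf_of_real[OF *])
    finally show "Re (trace (matrix_series (\<lambda>k. of_real (c k)) (psd_powr D r)))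
      = (\<Sum>i\<in>UNIV. \<Sum>k. c k * (d i powr r) ^ k)"
      by simp
  qed
  \<comment> \<open>The hypotheses bound the powers of \<open>a i\<close> and \<open>b i\<close>
    separately; absolute convergence at the eigenvalue \<open>a i * b i\<close> of
    \<open>A ** B\<close> comes from Young's majorant.\<close>
  have abs: "summable (\<lambda>k. cmod (\<alpha> k * of_real (a i * b i) ^ k))"
    and abs_eq: "cmod (\<alpha> k * of_real (a i * b i) ^ k) = c k * (a i * b i) ^ k" for i k
  proof -
    show *: "cmod (\<alpha> k * of_real (a i * b i) ^ k) = c k * (a i * b i) ^ k" for k
      using a[of i] b[of i] by (simp add: c_def norm_mult norm_power power_mult_distrib)
    show "summable (\<lambda>k. cmod (\<alpha> k * of_real (a i * b i) ^ k))"
      unfolding * using summ[OF A assms(9)] summ[OF B assms(10)] a b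
      by (intro summable_power_mult[OF assms(6-8)] c)
  qed
  have "trace (matrix_series \<alpha> (A ** B)) = (\<Sum>i\<in>UNIV. \<Sum>k. \<alpha> k * of_real (a i * b i) ^ k)"
    unfolding A B unitary_diagonal_mult[OF U]
    by (rule trace_matrix_series_unitary_diagonal[OF U summable_norm_cancel[OF abs]])
  \<comment> \<open>Triangle inequality twice, over the eigenvalues and inside each series.\<close>
  also have "cmod \<dots> \<le> (\<Sum>i\<in>UNIV. \<Sum>k. c k * (a i * b i) ^ k)"
    by (intro sum_norm_le) (use summable_norm[OF abs] in \<open>simp only: abs_eq\<close>)
  also have "\<dots> \<le> (\<Sum>i\<in>UNIV. \<Sum>k. c k * (a i powr p) ^ k) powr (1 / p)
      * (\<Sum>i\<in>UNIV. \<Sum>k. c k * (b i powr q) ^ k) powr (1 / q)"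
    using summ[OF A assms(9)] summ[OF B assms(10)]
    by (intro Hoelder_power_series assms(6-8) a b c) auto
  finally show ?thesis
    using series[OF A assms(9)] series[OF B assms(10)] by (simp add: c_def)
qed

end
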